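(* Let $I$ be a finite set and $z:\mathcal P(I)\to\hat{\mathbb R}$ a submodular function. The map $\Phi_z$, from preorders on $I$ compatible with $z$ to non-empty faces of $\Pi(z)$, is surjective. The image of $\Psi_z$, from non-empty faces of $\Pi(z)$ to preorders compatible with $z$, is precisely the set $\mathrm{Pre}(z)$ of all preorders conforming to $z$. Hence $\Phi_z$ and $\Psi_z$ give a bijection $$\mathrm{Pre}(z)\ \overset{1-1}{\longleftrightarrow}\ \Gamma^*(z)$$ between the preorders conforming to $z$ and the non-empty faces of $\Pi(z)$.
   Context: Notation: $\hat{\mathbb R}=\mathbb R\cup\{\infty\}$; $\mathcal P(I)$ is the power set of the finite set $I$. A function $z:\mathcal P(I)\to\hat{\mathbb R}$ with $z(\emptyset)=0$ and $z(I)<\infty$ is submodular if $z(A\cup B)+z(A\cap B)\le z(A)+z(B)$ for all $A,B\subseteq I$. For $A\subseteq B\subseteq I$ with $z(A),z(B)<\infty$ let $z_{B/A}:\mathcal P(B\setminus A)\to\hat{\mathbb R}$, $z_{B/A}(U)=z(A\cup U)-z(A)$. A function $z'$ on $\mathcal P(C)$ decomposes along a partition $C=C_1\sqcup C_2$ (written $z'=z'|_{C_1}\cdot z'|_{C_2}$) if $z'(E)=z'(E\cap C_1)+z'(E\cap C_2)$ for all $E\subseteq C$. A preorder $P$ on $I$ is a reflexive transitive relation $\le_P$. A down-set $D$ of $P$ satisfies: $y\in D$, $x\le_P y$ imply $x\in D$. A convex subset is a set $C=B\setminus A$ with $A\subseteq B$ down-sets. $P$ restricted to $C$ decomposes as the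 disconnected union $C=C_1\sqcup C_2$ if no element of $C_1$ is comparable to an element of $C_2$. A preorder is determined by its family of down-sets, and any family of subsets of $I$ containing $\emptyset$, $I$ and closed under unions and intersections (a topology) is the family of down-sets of a unique preorder. $P$ is compatible with $z$ if (i) $z(A)<\infty$ for every down-set $A$ of $P$, and (ii) for all down-sets $A\subseteq B$ of $P$ with $C=B\setminus A$, whenever $P$ on $C$ decomposes as a disconnected union $C=C_1\sqcup C_2$, then $z_{B/A}$ decomposes along $C_1\sqcup C_2$. In that case $z_{B/A}$ depends only on $C=B\setminus A$ and is written $z_C$. $P$ conforms to $z$ if it is compatible with $z$ and, for every convex subset $C$ of $P$, whenever $z_C$ decomposes along $C=C_1\sqcup C_2$, then $P$ on $C$ is the disconnected union of $C_1$ and $C_2$. $\mathrm{Pre}(z)$ is the set of preorders on $I$ conforming to $z$. For $x=(x_i)_{i\in I}\in\mathbb RI$ (the real vector space with basis $I$) and $A\subseteq I$ let $x_A=\sum_{i\in A}x_i$. The extended generalized permutahedron of $z$ is the polyhedron $\Pi(z)=\{x\in\mathbb RI: x_I=z(I),\ x_A\le z(A)\text{ for all }A\subseteq I\text{ with }z(A)<\infty\}$. $\Gamma^*(z)$ is the set of its non-empty faces (including $\Pi(z)$ itself). For a preorder $P$ compatible with $z$, $\Phi_z(P)=\{x\in\Pi(z): x_A=z(A)\text{ for every down-set }A\text{ of }P\}$, which is a non-empty face. For a non-empty face $G$, the sets $A\subseteq I$ with $z(A)<\infty$ and $x_A=z(A)$ for all $x\in G$ form a topology, and $\Psi_z(G)$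 is the preorder whose down-sets are exactly these sets. *)

theory Defs
  imports "HOL-Analysis.Analysis" "HOL-Analysis.Finite_Function_Topology"
begin

text \<open>
  The ground set is a finite, possibly empty, set \<open>I :: 'a set\<close>. Set functions have type
  \<open>'a set \<Rightarrow> ereal\<close>; only their values on subsets of \<open>I\<close> are ever used, and
  \<open>submodular_on\<close> excludes the value \<open>-\<infinity>\<close>.
\<close>

definition submodular_on :: "'a set \<Rightarrow> ('a set \<Rightarrow> ereal) \<Rightarrow> bool" where
  "submodular_on I z \<longleftrightarrow>
     (\<forall>A\<subseteq>I. z A \<noteq> -\<infinity>) \<and> z {} = 0 \<and> z I < \<infinity> \<and>
     (\<forall>A B. A \<subseteq> I \<and> B \<subseteq> I \<longrightarrow> z (A \<union> B) + z (A \<inter> B) \<le> z A + z B)"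

text \<open>\<open>minor z A\<close> is $z_{B/A}$; it is meant to be evaluated on subsets of \<open>B - A\<close> only, where
  its values do not depend on \<open>B\<close>.\<close>

definition minor :: "('a set \<Rightarrow> ereal) \<Rightarrow> 'a set \<Rightarrow> 'a set \<Rightarrow> ereal" where
  "minor z A U = z (A \<union> U) - z A"

text \<open>Here and in \<open>disconnected_union\<close> the parts of a partition may be empty: both notions then
  hold trivially (for set functions that vanish at the empty set).\<close>

definition decomposes :: "('a set \<Rightarrow> ereal) \<Rightarrow> 'a set \<Rightarrow> 'a set \<Rightarrow> 'a set \<Rightarrow> bool" where
  "decomposes z' C C1 C2 \<longleftrightarrow>
     C = C1 \<union> C2 \<and> C1 \<inter> C2 = {} \<and> (\<forall>E\<subseteq>C. z' E = z' (E \<inter> C1) + z' (E \<inter> C2))"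

text \<open>A preorder \<open>P\<close> on \<open>I\<close> is a relation with \<open>preorder_on I P\<close>, where \<open>(x, y) \<in> P\<close> means
  $x \le_P y$.\<close>

definition disconnected_union :: "('a \<times> 'a) set \<Rightarrow> 'a set \<Rightarrow> 'a set \<Rightarrow> 'a set \<Rightarrow> bool" where
  "disconnected_union P C C1 C2 \<longleftrightarrow>
     C = C1 \<union> C2 \<and> C1 \<inter> C2 = {} \<and> (\<forall>x\<in>C1. \<forall>y\<in>C2. (x, y) \<notin> P \<and> (y, x) \<notin> P)"

definition down_sets :: "'a set \<Rightarrow> ('a \<times> 'a) set \<Rightarrow> 'a set set" where
  "down_sets I P = {D. D \<subseteq> I \<and> (\<forall>x y. y \<in> D \<and> (x, y) \<in> P \<longrightarrow> x \<in> D)}"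

definition compatible :: "'a set \<Rightarrow> ('a set \<Rightarrow> ereal) \<Rightarrow> ('a \<times> 'a) set \<Rightarrow> bool" where
  "compatible I z P \<longleftrightarrow>
     preorder_on I P \<and>
     (\<forall>A\<in>down_sets I P. z A < \<infinity>) \<and>
     (\<forall>A\<in>down_sets I P. \<forall>B\<in>down_sets I P. A \<subseteq> B \<longrightarrow>
        (\<forall>C1 C2. disconnected_union P (B - A) C1 C2 \<longrightarrow> decomposes (minor z A) (B - A) C1 C2))"

text \<open>The convex subsets are the sets \<open>B - A\<close> for down-sets \<open>A \<subseteq> B\<close>. For compatible \<open>P\<close> the
  function $z_{B/A}$ depends only on \<open>B - A\<close>, so ranging over all pairs \<open>(A, B)\<close> amounts to
  ranging over all convex subsets.\<close>

definition conforms :: "'a set \<Rightarrow> ('a set \<Rightarrow> ereal) \<Rightarrow> ('a \<times> 'a) set \<Rightarrow> bool" where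
  "conforms I z P \<longleftrightarrow>
     compatible I z P \<and>
     (\<forall>A\<in>down_sets I P. \<forall>B\<in>down_sets I P. A \<subseteq> B \<longrightarrow>
        (\<forall>C1 C2. decomposes (minor z A) (B - A) C1 C2 \<longrightarrow> disconnected_union P (B - A) C1 C2))"

definition Pre :: "'a set \<Rightarrow> ('a set \<Rightarrow> ereal) \<Rightarrow> ('a \<times> 'a) set set" where
  "Pre I z = {P. conforms I z P}"

text \<open>The real vector space with basis \<open>I\<close> consists of the finitely supported functions on the
  ambient type whose support lies in \<open>I\<close>. (With vectors indexed by a type, \<open>I\<close> could not be
  empty.)\<close>

definition coord_sum :: "('a \<Rightarrow>\<^sub>0 real) \<Rightarrow> 'a set \<Rightarrow> real" where
  "coord_sum x A = (\<Sum>i\<in>A. Poly_Mapping.lookup x i)"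

definition gen_perm :: "'a set \<Rightarrow> ('a set \<Rightarrow> ereal) \<Rightarrow> ('a \<Rightarrow>\<^sub>0 real) set" where
  "gen_perm I z =
     {x. Poly_Mapping.keys x \<subseteq> I \<and> ereal (coord_sum x I) = z I \<and>
         (\<forall>A\<subseteq>I. z A < \<infinity> \<longrightarrow> ereal (coord_sum x A) \<le> z A)}"

definition nonempty_faces :: "'a set \<Rightarrow> ('a set \<Rightarrow> ereal) \<Rightarrow> ('a \<Rightarrow>\<^sub>0 real) set set" where
  "nonempty_faces I z = {G. G face_of gen_perm I z \<and> G \<noteq> {}}"

definition Phi :: "'a set \<Rightarrow> ('a set \<Rightarrow> ereal) \<Rightarrow> ('a \<times> 'a) set \<Rightarrow> ('a \<Rightarrow>\<^sub>0 real) set" where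
  "Phi I z P = {x \<in> gen_perm I z. \<forall>A\<in>down_sets I P. ereal (coord_sum x A) = z A}"

definition tight_sets :: "'a set \<Rightarrow> ('a set \<Rightarrow> ereal) \<Rightarrow> ('a \<Rightarrow>\<^sub>0 real) set \<Rightarrow> 'a set set" where
  "tight_sets I z G = {A. A \<subseteq> I \<and> z A < \<infinity> \<and> (\<forall>x\<in>G. ereal (coord_sum x A) = z A)}"

definition Psi :: "'a set \<Rightarrow> ('a set \<Rightarrow> ereal) \<Rightarrow> ('a \<Rightarrow>\<^sub>0 real) set \<Rightarrow> ('a \<times> 'a) set" where
  "Psi I z G = (THE P. preorder_on I P \<and> down_sets I P = tight_sets I z G)"

text \<open>The definite description in \<open>Psi\<close> is justified by the next lemma, since the tight sets of a
  non-empty face form a topology on \<open>I\<close>.\<close>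

lemma ex1_preorder_of_topology:
  fixes I :: "'a set"
  assumes fin: "finite I" and sub: "T \<subseteq> Pow I" and bot: "{} \<in> T" and top: "I \<in> T"
    and un: "\<And>A B. A \<in> T \<Longrightarrow> B \<in> T \<Longrightarrow> A \<union> B \<in> T"
    and int: "\<And>A B. A \<in> T \<Longrightarrow> B \<in> T \<Longrightarrow> A \<inter> B \<in> T"
  shows "\<exists>!P. preorder_on I P \<and> down_sets I P = T"
proof (rule ex_ex1I)
  let ?P = "{(x, y). x \<in> I \<and> y \<in> I \<and> (\<forall>A\<in>T. y \<in> A \<longrightarrow> x \<in> A)}"
  have finT: "finite T"
    using fin sub by (meson finite_Pow_iff finite_subset)
  have "preorder_on I ?P"
    by (auto simp: preorder_on_def refl_on_def trans_def)
  moreover have "down_sets I ?P = T"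
  proof
    show "T \<subseteq> down_sets I ?P"
      using sub by (auto simp: down_sets_def)
    show "down_sets I ?P \<subseteq> T"
    proof
      fix D assume D: "D \<in> down_sets I ?P"
      define U where "U y = \<Inter> {A \<in> T. y \<in> A}" for y
      have UT: "U y \<in> T" if "y \<in> I" for y
      proof -
        have "\<Inter> F \<in> T" if "finite F" "F \<noteq> {}" "F \<subseteq> T" for F
          using that
        proof (induction rule: finite_ne_induct)
          case (insert A F)
          then show ?case using int[of A "\<Inter> F"] by simp
        qed simp
        moreover have "{A \<in> T. y \<in> A} \<noteq> {}" using that top by auto
        ultimately show ?thesis
          unfolding U_def using finT by simp
      qed
      have DI: "D \<subseteq> I" using D by (auto simp: down_sets_def)
      have "D = (\<Union>y\<in>D. U y)"
      proof
        show "D \<subseteq> (\<Union>y\<in>D. U y)" by (auto simp: U_def)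
        show "(\<Union>y\<in>D. U y) \<subseteq> D"
        proof
          fix x assume "x \<in> (\<Union>y\<in>D. U y)"
          then obtain y where y: "y \<in> D" "x \<in> U y" by blast
          then have "(x, y) \<in> ?P" using DI top unfolding U_def by blast
          then show "x \<in> D" using D y unfolding down_sets_def by blast
        qed
      qed
      moreover have UF: "(\<Union>y\<in>F. U y) \<in> T" if "finite F" "F \<subseteq> I" for F
        using that
      proof (induction rule: finite_induct)
        case (insert y F)
        then show ?case using un[OF UT[of y], of "\<Union>y\<in>F. U y"] by simp
      qed (simp add: bot)
      ultimately show "D \<in> T"
        using UF[OF finite_subset[OF DI fin] DI] by simp
    qed
  qed
  ultimately show "\<exists>P. preorder_on I P \<and> down_sets I P = T" by blast
next
  fix P Q
  assume PQ: "preorder_on I P \<and> down_sets I P = T" "preorder_on I Q \<and> down_sets I Q = T"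
  have *: "P \<subseteq> Q" if P: "preorder_on I P" and Q: "preorder_on I Q"
    and eq: "down_sets I P = down_sets I Q" for P Q :: "('a \<times> 'a) set"
  proof
    fix p assume "p \<in> P"
    then obtain x y where p: "p = (x, y)" "(x, y) \<in> P" by (cases p) auto
    have y: "y \<in> I" using p P by (auto simp: preorder_on_def)
    have "{x. (x, y) \<in> Q} \<in> down_sets I Q"
      using Q unfolding preorder_on_def down_sets_def by (blast dest: transD)
    then have "{x. (x, y) \<in> Q} \<in> down_sets I P"
      by (simp add: eq)
    moreover have "(y, y) \<in> Q" using Q y by (auto simp: preorder_on_def refl_on_def)
    ultimately show "p \<in> Q"
      using p unfolding down_sets_def by blast
  qed
  show "P = Q" using *[of P Q] *[of Q P] PQ by auto
qed

end

theory Submission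
  imports Defs
begin

text \<open>
  Where \<open>z\<close> is finite it is a real submodular function \<open>f\<close> on a lattice \<open>F\<close> of subsets
  of \<open>I\<close>, and \<open>\<Pi>(z)\<close> is the polyhedron of the points \<open>x\<close> with \<open>x\<^sub>I = f I\<close> and \<open>x\<^sub>A \<le> f A\<close> for
  \<open>A \<in> F\<close>. A set is tight at \<open>x\<close> if \<open>x\<^sub>A = f A\<close>. Preorders correspond to sublattices \<open>D\<close> of the
  power set through their down-sets, so the whole statement is one about sublattices.

  The first step is to see what compatibility and conformity say about \<open>D\<close>. By submodularity,
  \<open>z\<^sub>B\<^sub>/\<^sub>A\<close> decomposes along \<open>C\<^sub>1 \<squnion> C\<^sub>2\<close> as soon as the single equation
  \<open>f (A \<union> C\<^sub>1) + f (A \<union> C\<^sub>2) = f A + f B\<close> between finite values holds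
  (\<open>decomposes_iff\<close>), and \<open>P\<close> on \<open>B - A\<close> is the disconnected union of \<open>C\<^sub>1\<close> and \<open>C\<^sub>2\<close> exactly
  if \<open>A \<union> C\<^sub>1\<close> and \<open>A \<union> C\<^sub>2\<close> are down-sets. Hence compatible means that \<open>f\<close> is finite and
  modular on \<open>D\<close>, and conforming means that in addition \<open>D\<close> is saturated: it contains \<open>U, V \<in> F\<close>
  whenever it contains \<open>U \<union> V\<close> and \<open>U \<inter> V\<close> and \<open>f\<close> is modular on the pair \<open>(U, V)\<close>.

  The tight sets of any point of the polyhedron form a modular saturated sublattice, because
  \<open>x\<^sub>A\<close> is modular in \<open>A\<close> and bounded by \<open>f\<close>. Two existence results go in the opposite direction.
  If \<open>f\<close> is modular on \<open>D\<close>, some point is tight on all of \<open>D\<close> (\<open>ex_base_point_tight_on\<close>, by gluing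
  a point for \<open>A\<close> to a point for \<open>I - A\<close>); this makes \<open>\<Phi>\<close> of a compatible preorder non-empty. If
  \<open>D\<close> is also saturated, some point is tight on \<open>D\<close> and nowhere else
  (\<open>ex_base_point_tight_exactly\<close>, by moving mass between two coordinates); this gives
  \<open>\<Psi> (\<Phi> P) = P\<close> for conforming \<open>P\<close>.

  A face \<open>G\<close> has a point \<open>g\<close> with the fewest tight sets, and taking midpoints shows that these
  are tight on all of \<open>G\<close>. If \<open>x\<close> is tight wherever \<open>g\<close> is, the segment from \<open>x\<close> to \<open>g\<close> can be
  prolonged beyond \<open>g\<close> inside the polyhedron, so \<open>x \<in> G\<close>. Thus \<open>G\<close> is cut out by its tight
  sets, which says that \<open>\<Phi> (\<Psi> G) = G\<close>, and \<open>\<Psi> G\<close> conforms since its down-sets are the tight sets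
  of \<open>g\<close>.
\<close>

section \<open>Coordinate sums\<close>

lemma lookup_scaleR:
  "Poly_Mapping.lookup (c *\<^sub>R x) i = c *\<^sub>R Poly_Mapping.lookup x i"
proof -
  have "finite {i. c *\<^sub>R Poly_Mapping.lookup x i \<noteq> 0}"
    by (rule finite_subset[OF _ finite_lookup[of x]]) auto
  then show ?thesis by (simp add: scaleR_poly_mapping_def)
qed

lemma keys_scaleR_subset: "Poly_Mapping.keys (c *\<^sub>R x) \<subseteq> Poly_Mapping.keys x"
  by (auto simp: in_keys_iff lookup_scaleR)

lemma keys_diff_subset:
  fixes x y :: "'a \<Rightarrow>\<^sub>0 real"
  shows "Poly_Mapping.keys (x - y) \<subseteq> Poly_Mapping.keys x \<union> Poly_Mapping.keys y"
  by (auto simp: in_keys_iff lookup_minus)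

lemma coord_sum_add: "coord_sum (x + y) A = coord_sum x A + coord_sum y A"
  by (simp add: coord_sum_def lookup_add sum.distrib)

lemma coord_sum_diff: "coord_sum (x - y) A = coord_sum x A - coord_sum y A"
  by (simp add: coord_sum_def lookup_minus sum_subtractf)

lemma coord_sum_scaleR: "coord_sum (c *\<^sub>R x) A = c * coord_sum x A"
  by (simp add: coord_sum_def lookup_scaleR sum_distrib_left)

lemma coord_sum_empty [simp]: "coord_sum x {} = 0"
  by (simp add: coord_sum_def)

lemma coord_sum_zero [simp]: "coord_sum 0 A = 0"
  by (simp add: coord_sum_def)

lemma coord_sum_single:
  "finite A \<Longrightarrow> coord_sum (Poly_Mapping.single i c) A = (if i \<in> A then c else 0)"
  by (simp add: coord_sum_def lookup_single when_def)

lemma coord_sum_Un_Int: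
  "finite A \<Longrightarrow> finite B \<Longrightarrow>
     coord_sum x (A \<union> B) + coord_sum x (A \<inter> B) = coord_sum x A + coord_sum x B"
  by (simp add: coord_sum_def sum.union_inter)

lemma coord_sum_Int_keys:
  "finite B \<Longrightarrow> Poly_Mapping.keys x \<subseteq> A \<Longrightarrow> coord_sum x B = coord_sum x (B \<inter> A)"
  unfolding coord_sum_def by (rule sum.mono_neutral_right) (auto simp: in_keys_iff)

section \<open>Submodular functions on a lattice of sets\<close>

locale submodular_lattice =
  fixes I :: "'a set" and F :: "'a set set" and f :: "'a set \<Rightarrow> real"
  assumes finite_ground: "finite I"
    and F_sub: "A \<in> F \<Longrightarrow> A \<subseteq> I"
    and empty_F: "{} \<in> F" and ground_F: "I \<in> F"
    and Un_F: "A \<in> F \<Longrightarrow> B \<in> F \<Longrightarrow> A \<union> B \<in> F"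
    and Int_F: "A \<in> F \<Longrightarrow> B \<in> F \<Longrightarrow> A \<inter> B \<in> F"
    and f_empty: "f {} = 0"
    and submod: "A \<in> F \<Longrightarrow> B \<in> F \<Longrightarrow> f (A \<union> B) + f (A \<inter> B) \<le> f A + f B"

definition base_polyhedron :: "'a set \<Rightarrow> 'a set set \<Rightarrow> ('a set \<Rightarrow> real) \<Rightarrow> ('a \<Rightarrow>\<^sub>0 real) set" where
  "base_polyhedron I F f =
     {x. Poly_Mapping.keys x \<subseteq> I \<and> coord_sum x I = f I \<and> (\<forall>A\<in>F. coord_sum x A \<le> f A)}"

definition tight :: "'a set set \<Rightarrow> ('a set \<Rightarrow> real) \<Rightarrow> ('a \<Rightarrow>\<^sub>0 real) \<Rightarrow> 'a set set" where
  "tight F f x = {A \<in> F. coord_sum x A = f A}"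

definition modular_sublattice :: "'a set \<Rightarrow> 'a set set \<Rightarrow> ('a set \<Rightarrow> real) \<Rightarrow> 'a set set \<Rightarrow> bool" where
  "modular_sublattice I F f D \<longleftrightarrow> D \<subseteq> F \<and> {} \<in> D \<and> I \<in> D \<and>
     (\<forall>A\<in>D. \<forall>B\<in>D. A \<union> B \<in> D \<and> A \<inter> B \<in> D \<and> f (A \<union> B) + f (A \<inter> B) = f A + f B)"

text \<open>For the down-sets of a compatible preorder this is conformity; see \<open>conforms_iff\<close>.\<close>

definition saturated :: "'a set set \<Rightarrow> ('a set \<Rightarrow> real) \<Rightarrow> 'a set set \<Rightarrow> bool" where
  "saturated F f D \<longleftrightarrow>
     (\<forall>U\<in>F. \<forall>V\<in>F. U \<union> V \<in> D \<and> U \<inter> V \<in> D \<and> f (U \<union> V) + f (U \<inter> V) = f U + f V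
        \<longrightarrow> U \<in> D \<and> V \<in> D)"

lemma modular_sublatticeD:
  assumes "modular_sublattice I F f D"
  shows "D \<subseteq> F" "{} \<in> D" "I \<in> D"
    and "\<And>A B. A \<in> D \<Longrightarrow> B \<in> D \<Longrightarrow> A \<union> B \<in> D"
    and "\<And>A B. A \<in> D \<Longrightarrow> B \<in> D \<Longrightarrow> A \<inter> B \<in> D"
    and "\<And>A B. A \<in> D \<Longrightarrow> B \<in> D \<Longrightarrow> f (A \<union> B) + f (A \<inter> B) = f A + f B"
  using assms unfolding modular_sublattice_def by blast+

context submodular_lattice
begin

lemma finite_F: "finite F"
  by (rule finite_subset[of _ "Pow I"]) (use F_sub finite_ground in auto)

lemma finite_member: "A \<in> F \<Longrightarrow> finite A"
  using F_sub finite_ground finite_subset by blast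

lemma finite_tight: "finite (tight F f x)"
  using finite_F by (simp add: tight_def)

lemma restrict_submodular_lattice:
  assumes "A \<in> F"
  shows "submodular_lattice A {B \<in> F. B \<subseteq> A} f"
  by (unfold_locales)
    (use assms finite_member empty_F Un_F Int_F f_empty submod in auto)

lemma contract_submodular_lattice:
  assumes A: "A \<in> F"
  shows "submodular_lattice (I - A) {U. U \<subseteq> I - A \<and> A \<union> U \<in> F} (\<lambda>U. f (A \<union> U) - f A)"
proof
  fix U V assume *: "U \<in> {U. U \<subseteq> I - A \<and> A \<union> U \<in> F}" "V \<in> {U. U \<subseteq> I - A \<and> A \<union> U \<in> F}"
  have eq: "A \<union> (U \<union> V) = (A \<union> U) \<union> (A \<union> V)" "A \<union> (U \<inter> V) = (A \<union> U) \<inter> (A \<union> V)"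
    by blast+
  show "U \<union> V \<in> {U. U \<subseteq> I - A \<and> A \<union> U \<in> F}"
    using * Un_F[of "A \<union> U" "A \<union> V"] by (auto simp: eq(1))
  show "U \<inter> V \<in> {U. U \<subseteq> I - A \<and> A \<union> U \<in> F}"
    using * Int_F[of "A \<union> U" "A \<union> V"] by (auto simp: eq(2))
  show "f (A \<union> (U \<union> V)) - f A + (f (A \<union> (U \<inter> V)) - f A) \<le> f (A \<union> U) - f A + (f (A \<union> V) - f A)"
    using submod[of "A \<union> U" "A \<union> V"] * by (simp add: eq)
qed (use A F_sub finite_ground ground_F in \<open>auto simp: Un_absorb1\<close>)

end

section \<open>Points that are tight on a modular sublattice\<close>

lemma modular_sublattice_restrict:
  assumes "modular_sublattice I F f D" "A \<in> D"
  shows "modular_sublattice A {B \<in> F. B \<subseteq> A} f {B \<in> D. B \<subseteq> A}"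
  using assms unfolding modular_sublattice_def by blast

lemma modular_sublattice_contract:
  assumes D: "modular_sublattice I F f D" and A: "A \<in> D" "A \<subseteq> I"
  shows "modular_sublattice (I - A) {U. U \<subseteq> I - A \<and> A \<union> U \<in> F} (\<lambda>U. f (A \<union> U) - f A)
           {U. U \<subseteq> I - A \<and> A \<union> U \<in> D}"
proof -
  note D' = modular_sublatticeD[OF D]
  show ?thesis
    unfolding modular_sublattice_def
  proof (intro conjI ballI)
    fix U V assume *: "U \<in> {U. U \<subseteq> I - A \<and> A \<union> U \<in> D}" "V \<in> {U. U \<subseteq> I - A \<and> A \<union> U \<in> D}"
    have eq: "A \<union> (U \<union> V) = (A \<union> U) \<union> (A \<union> V)" "A \<union> (U \<inter> V) = (A \<union> U) \<inter> (A \<union> V)"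
      by blast+
    show "U \<union> V \<in> {U. U \<subseteq> I - A \<and> A \<union> U \<in> D}"
      using * D'(4)[of "A \<union> U" "A \<union> V"] by (auto simp: eq(1))
    show "U \<inter> V \<in> {U. U \<subseteq> I - A \<and> A \<union> U \<in> D}"
      using * D'(5)[of "A \<union> U" "A \<union> V"] by (auto simp: eq(2))
    show "f (A \<union> (U \<union> V)) - f A + (f (A \<union> (U \<inter> V)) - f A) = f (A \<union> U) - f A + (f (A \<union> V) - f A)"
      using D'(6)[of "A \<union> U" "A \<union> V"] * by (simp add: eq)
  qed (use A D' in \<open>auto simp: Un_absorb1\<close>)
qed

text \<open>
  For \<open>A \<in> D\<close> with \<open>A \<noteq> {}\<close> and \<open>A \<noteq> I\<close>, points \<open>x\<^sub>1\<close> for the restriction to \<open>A\<close> and \<open>x\<^sub>2\<close> for the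
  contraction by \<open>A\<close> have as sum a point for \<open>I\<close>: by submodularity
  \<open>f (B \<inter> A) + (f (A \<union> B) - f A) \<le> f B\<close>, with equality for \<open>B \<in> D\<close> by modularity. The induction
  bottoms out where \<open>F\<close> itself is trivial.
\<close>

lemma ex_base_point_tight_on:
  assumes "submodular_lattice I F f" and "modular_sublattice I F f D"
  shows "\<exists>x\<in>base_polyhedron I F f. D \<subseteq> tight F f x"
  using assms
proof (induction "card I" arbitrary: I F f D rule: less_induct)
  case less
  interpret submodular_lattice I F f by fact
  note D = modular_sublatticeD[OF less.prems(2)]
  show ?case
  proof (cases "F \<subseteq> {{}, I}")
    case True
    have exact: ?thesis if x: "Poly_Mapping.keys x \<subseteq> I" "coord_sum x I = f I" for x
    proof -
      have "coord_sum x B = f B" if "B \<in> F" for B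
      proof -
        have "B = {} \<or> B = I" using True that by blast
        then show ?thesis using x f_empty by auto
      qed
      then have "x \<in> base_polyhedron I F f" "D \<subseteq> tight F f x"
        using x D(1) by (auto simp: base_polyhedron_def tight_def)
      then show ?thesis by blast
    qed
    show ?thesis
    proof (cases "I = {}")
      case True
      then show ?thesis using exact[of 0] f_empty by simp
    next
      case False
      then obtain i where "i \<in> I" by blast
      then show ?thesis
        using exact[of "Poly_Mapping.single i (f I)"] finite_ground
        by (simp add: coord_sum_single split: if_splits)
    qed
  next
    case False
    \<comment> \<open>The set at which to split must lie in \<open>D\<close>. If \<open>D\<close> is trivial, any \<open>A \<in> F\<close> may be added to it,
      since \<open>f\<close> is modular on a chain.\<close>
    obtain A D' where A: "A \<in> D'" "A \<noteq> {}" "A \<noteq> I"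
      and D': "D \<subseteq> D'" "modular_sublattice I F f D'"
    proof (cases "D \<subseteq> {{}, I}")
      case True
      obtain A where A: "A \<in> F" "A \<noteq> {}" "A \<noteq> I"
        using False by blast
      have "A \<subseteq> I" using A(1) by (rule F_sub)
      then have "modular_sublattice I F f {{}, A, I}"
        using A empty_F ground_F f_empty
        by (auto simp: modular_sublattice_def Un_absorb1 Un_absorb2 Int_absorb1 Int_absorb2)
      then show ?thesis using that[of A "{{}, A, I}"] A True by blast
    next
      case False
      then show ?thesis using that[of _ D] less.prems(2) by blast
    qed
    note DD = modular_sublatticeD[OF D'(2)]
    have AF: "A \<in> F" using A DD by blast
    have AI: "A \<subseteq> I" using AF by (rule F_sub)
    let ?F1 = "{B \<in> F. B \<subseteq> A}"
    let ?F2 = "{U. U \<subseteq> I - A \<and> A \<union> U \<in> F}" and ?f2 = "\<lambda>U. f (A \<union> U) - f A"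
    have "card A < card I" "card (I - A) < card I"
      using A AI finite_ground by (auto intro!: psubset_card_mono)
    obtain x1 where x1: "x1 \<in> base_polyhedron A ?F1 f" "{B \<in> D'. B \<subseteq> A} \<subseteq> tight ?F1 f x1"
      using less.hyps[OF \<open>card A < card I\<close> restrict_submodular_lattice[OF AF]
          modular_sublattice_restrict[OF D'(2) A(1)]] by blast
    obtain x2 where x2: "x2 \<in> base_polyhedron (I - A) ?F2 ?f2"
        "{U. U \<subseteq> I - A \<and> A \<union> U \<in> D'} \<subseteq> tight ?F2 ?f2 x2"
      using less.hyps[OF \<open>card (I - A) < card I\<close> contract_submodular_lattice[OF AF]
          modular_sublattice_contract[OF D'(2) A(1) AI]] by blast
    have keys: "Poly_Mapping.keys x1 \<subseteq> A" "Poly_Mapping.keys x2 \<subseteq> I - A"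
      using x1 x2 by (auto simp: base_polyhedron_def)
    have split: "coord_sum (x1 + x2) B = coord_sum x1 (B \<inter> A) + coord_sum x2 (B - A)"
      if "B \<in> F" for B
    proof -
      have "B \<inter> (I - A) = B - A" using F_sub[OF that] by blast
      then show ?thesis
        using coord_sum_Int_keys[OF finite_member[OF that] keys(1)]
          coord_sum_Int_keys[OF finite_member[OF that] keys(2)]
        by (simp add: coord_sum_add)
    qed
    have le: "coord_sum (x1 + x2) B \<le> f B" if B: "B \<in> F" for B
    proof -
      have "A \<union> (B - A) = A \<union> B" by blast
      moreover have "B \<inter> A \<in> ?F1" "B - A \<in> ?F2"
        using Int_F[OF B AF] Un_F[OF AF B] F_sub[OF B] by auto
      moreover have "\<forall>U\<in>?F1. coord_sum x1 U \<le> f U" "\<forall>U\<in>?F2. coord_sum x2 U \<le> f (A \<union> U) - f A"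
        using x1(1) x2(1) unfolding base_polyhedron_def by blast+
      ultimately have "coord_sum x1 (B \<inter> A) \<le> f (B \<inter> A)" "coord_sum x2 (B - A) \<le> f (A \<union> B) - f A"
        by metis+
      with submod[OF AF B] show ?thesis
        by (simp add: split[OF B] Int_commute)
    qed
    have eq: "coord_sum (x1 + x2) B = f B" if B: "B \<in> D'" for B
    proof -
      have BF: "B \<in> F" using B DD by blast
      have Un: "A \<union> (B - A) = A \<union> B" by blast
      then have "B \<inter> A \<in> {B \<in> D'. B \<subseteq> A}" "B - A \<in> {U. U \<subseteq> I - A \<and> A \<union> U \<in> D'}"
        using DD(4)[OF A(1) B] DD(5)[OF B A(1)] F_sub[OF BF] by auto
      then have "coord_sum x1 (B \<inter> A) = f (B \<inter> A)" "coord_sum x2 (B - A) = f (A \<union> B) - f A"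
        using x1(2) x2(2) unfolding tight_def Un[symmetric] by blast+
      with DD(6)[OF A(1) B] show ?thesis
        by (simp add: split[OF BF] Int_commute)
    qed
    have "x1 + x2 \<in> base_polyhedron I F f"
      using keys AI keys_add[of x1 x2] le eq[OF DD(3)] by (auto simp: base_polyhedron_def)
    moreover have "D \<subseteq> tight F f (x1 + x2)"
      using eq D' DD(1) by (auto simp: tight_def)
    ultimately show ?thesis by blast
  qed
qed

section \<open>Tight sets and small perturbations\<close>

context submodular_lattice
begin

abbreviation "\<B> \<equiv> base_polyhedron I F f"
abbreviation "\<T> \<equiv> tight F f"

lemma tight_Un_Int:
  assumes x: "x \<in> \<B>" and "A \<in> \<T> x" "B \<in> \<T> x"
  shows "A \<union> B \<in> \<T> x" "A \<inter> B \<in> \<T> x" "f (A \<union> B) + f (A \<inter> B) = f A + f B"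
proof -
  have F: "A \<in> F" "B \<in> F" "A \<union> B \<in> F" "A \<inter> B \<in> F" and "coord_sum x A = f A" "coord_sum x B = f B"
    using assms Un_F Int_F by (auto simp: tight_def)
  moreover have "coord_sum x (A \<union> B) \<le> f (A \<union> B)" "coord_sum x (A \<inter> B) \<le> f (A \<inter> B)"
    using x F by (auto simp: base_polyhedron_def)
  moreover note coord_sum_Un_Int[of A B x] submod[of A B] finite_member
  ultimately show "A \<union> B \<in> \<T> x" "A \<inter> B \<in> \<T> x" "f (A \<union> B) + f (A \<inter> B) = f A + f B"
    by (fastforce simp: tight_def)+
qed

lemma modular_sublattice_tight:
  assumes "x \<in> \<B>"
  shows "modular_sublattice I F f (\<T> x)"
  using assms tight_Un_Int[OF assms] empty_F ground_F f_empty
  by (auto simp: modular_sublattice_def tight_def base_polyhedron_def)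

lemma saturated_tight:
  assumes x: "x \<in> \<B>"
  shows "saturated F f (\<T> x)"
  unfolding saturated_def
proof (intro ballI impI)
  fix U V assume F: "U \<in> F" "V \<in> F"
    and *: "U \<union> V \<in> \<T> x \<and> U \<inter> V \<in> \<T> x \<and> f (U \<union> V) + f (U \<inter> V) = f U + f V"
  have "coord_sum x U \<le> f U" "coord_sum x V \<le> f V"
    using x F by (auto simp: base_polyhedron_def)
  then show "U \<in> \<T> x \<and> V \<in> \<T> x"
    using * F coord_sum_Un_Int[of U V x] finite_member by (auto simp: tight_def)
qed

text \<open>
  Constraints that are slack at \<open>x\<close> survive a short step in any direction, so only the tight ones
  restrict \<open>d\<close>. No new tight set appears, and a tight set on which \<open>d\<close> decreases stops being tight.
\<close>

lemma ex_small_step: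
  assumes x: "x \<in> \<B>" and keys: "Poly_Mapping.keys d \<subseteq> I" and dI: "coord_sum d I = 0"
    and d: "\<And>A. A \<in> \<T> x \<Longrightarrow> coord_sum d A \<le> 0"
  shows "\<exists>e>0. x + e *\<^sub>R d \<in> \<B> \<and> \<T> (x + e *\<^sub>R d) \<subseteq> {A \<in> \<T> x. coord_sum d A = 0}"
proof -
  have "eventually (\<lambda>e. coord_sum x A + e * coord_sum d A \<le> f A \<and>
      (coord_sum x A + e * coord_sum d A = f A \<longrightarrow> A \<in> \<T> x \<and> coord_sum d A = 0)) (at_right 0)"
    (is "eventually (?ok A) _") if A: "A \<in> F" for A
  proof (cases "A \<in> \<T> x")
    case True
    then have "coord_sum x A = f A" "coord_sum d A \<le> 0" using d by (auto simp: tight_def)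
    then have "?ok A e" if "e > 0" for e
      using that True by (auto simp: mult_le_0_iff)
    then show ?thesis
      by (rule eventually_mono[OF eventually_at_right_less, rotated])
  next
    case False
    then have "coord_sum x A < f A"
      using x A by (force simp: base_polyhedron_def tight_def)
    moreover have "((\<lambda>e. coord_sum x A + e * coord_sum d A) \<longlongrightarrow> coord_sum x A + 0 * coord_sum d A) (at_right 0)"
      by (intro tendsto_intros)
    ultimately have "eventually (\<lambda>e. coord_sum x A + e * coord_sum d A < f A) (at_right 0)"
      by (auto dest: order_tendstoD(2))
    then show ?thesis by (rule eventually_mono) auto
  qed
  then have "eventually (\<lambda>e. \<forall>A\<in>F. ?ok A e) (at_right 0)"
    using finite_F by (simp add: eventually_ball_finite)
  then have "eventually (\<lambda>e. e > 0 \<and> (\<forall>A\<in>F. ?ok A e)) (at_right (0::real))"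
    using eventually_at_right_less[of "0::real"] by (rule eventually_elim2) auto
  then obtain e where e: "e > 0" and ok: "\<And>A. A \<in> F \<Longrightarrow> ?ok A e"
    using eventually_happens'[OF trivial_limit_at_right_real] by blast
  have "Poly_Mapping.keys (x + e *\<^sub>R d) \<subseteq> I"
    using x keys keys_add[of x "e *\<^sub>R d"] keys_scaleR_subset[of e d]
    by (auto simp: base_polyhedron_def)
  then have "x + e *\<^sub>R d \<in> \<B>" 
    using x ok dI by (auto simp: base_polyhedron_def coord_sum_add coord_sum_scaleR)
  moreover have "\<T> (x + e *\<^sub>R d) \<subseteq> {A \<in> \<T> x. coord_sum d A = 0}"
    using ok by (auto simp: tight_def coord_sum_add coord_sum_scaleR)
  ultimately show ?thesis using e by blast
qed

section \<open>Faces\<close>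

lemma convex_combination_in_base:
  assumes "a \<in> \<B>" "b \<in> \<B>" "0 \<le> u" "0 \<le> v" "u + v = 1"
  shows "u *\<^sub>R a + v *\<^sub>R b \<in> \<B>"
proof -
  have "Poly_Mapping.keys (u *\<^sub>R a + v *\<^sub>R b) \<subseteq> I"
    by (intro order_trans[OF keys_add] Un_least order_trans[OF keys_scaleR_subset])
      (use assms(1,2) in \<open>auto simp: base_polyhedron_def\<close>)
  moreover have "u * coord_sum a A + v * coord_sum b A \<le> f A" if "A \<in> F" for A
    using assms that by (intro convex_bound_le) (auto simp: base_polyhedron_def)
  moreover have "u * f I + v * f I = f I"
    using assms by (metis distrib_right mult_1)
  ultimately show ?thesis
    using assms by (simp add: base_polyhedron_def coord_sum_add coord_sum_scaleR)
qed

text \<open>The slack at a proper convex combination is a positive combination of two non-negative slacks,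
  which vanishes only if both do.\<close>

lemma tight_convex_combination:
  assumes "a \<in> \<B>" "b \<in> \<B>" "0 < u" "0 < v" "u + v = 1"
  shows "\<T> (u *\<^sub>R a + v *\<^sub>R b) = \<T> a \<inter> \<T> b"
proof -
  have "u * coord_sum a A + v * coord_sum b A = f A \<longleftrightarrow> coord_sum a A = f A \<and> coord_sum b A = f A"
    if "A \<in> F" for A
  proof -
    have le: "coord_sum a A \<le> f A" "coord_sum b A \<le> f A"
      using assms that by (auto simp: base_polyhedron_def)
    have v: "v = 1 - u" using assms by simp
    have gap: "f A - (u * coord_sum a A + v * coord_sum b A)
        = u * (f A - coord_sum a A) + v * (f A - coord_sum b A)"
      unfolding v by (simp add: algebra_simps)
    have "u * coord_sum a A + v * coord_sum b A = f A
        \<longleftrightarrow> u * (f A - coord_sum a A) + v * (f A - coord_sum b A) = 0"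
      unfolding gap[symmetric] by linarith
    also have "\<dots> \<longleftrightarrow> u * (f A - coord_sum a A) = 0 \<and> v * (f A - coord_sum b A) = 0"
      using le assms(3,4) by (intro add_nonneg_eq_0_iff) simp_all
    also have "\<dots> \<longleftrightarrow> coord_sum a A = f A \<and> coord_sum b A = f A"
      using assms(3,4) by auto
    finally show ?thesis .
  qed
  then show ?thesis by (auto simp: tight_def coord_sum_add coord_sum_scaleR)
qed

lemma face_of_tight_on: "{x \<in> \<B>. D \<subseteq> \<T> x} face_of \<B>" if "D \<subseteq> F"
  unfolding face_of_def
proof (intro conjI ballI impI)
  show "convex {x \<in> \<B>. D \<subseteq> \<T> x}"
  proof (rule convexI)
    fix a b and u v :: real
    assume *: "a \<in> {x \<in> \<B>. D \<subseteq> \<T> x}" "b \<in> {x \<in> \<B>. D \<subseteq> \<T> x}" "0 \<le> u" "0 \<le> v" "u + v = 1"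
    have "coord_sum (u *\<^sub>R a + v *\<^sub>R b) A = f A" if "A \<in> D" for A
    proof -
      have "coord_sum a A = f A" "coord_sum b A = f A" using * that by (auto simp: tight_def)
      moreover have "u * f A + v * f A = f A" using *(5) by (metis distrib_right mult_1)
      ultimately show ?thesis by (simp add: coord_sum_add coord_sum_scaleR)
    qed
    moreover have "u *\<^sub>R a + v *\<^sub>R b \<in> \<B>"
      using * by (intro convex_combination_in_base) auto
    ultimately show "u *\<^sub>R a + v *\<^sub>R b \<in> {x \<in> \<B>. D \<subseteq> \<T> x}"
      using that by (auto simp: tight_def)
  qed
next
  fix a b x assume *: "a \<in> \<B>" "b \<in> \<B>" "x \<in> {x \<in> \<B>. D \<subseteq> \<T> x}" "x \<in> open_segment a b"
  then obtain u where "0 < u" "u < 1" "x = (1 - u) *\<^sub>R a + u *\<^sub>R b"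
    by (auto simp: in_segment)
  then have "\<T> x = \<T> a \<inter> \<T> b"
    using tight_convex_combination[of a b "1 - u" u] * by simp
  then show "a \<in> {x \<in> \<B>. D \<subseteq> \<T> x}" "b \<in> {x \<in> \<B>. D \<subseteq> \<T> x}" using * by auto
qed auto

text \<open>
  If \<open>g\<close> has the fewest tight sets, then passing to the midpoint of \<open>g\<close> and \<open>h\<close>, where exactly the
  common tight sets remain, cannot lose any of them. Such a \<open>g\<close> takes the place of a point in the
  relative interior.
\<close>

lemma ex_generic_point:
  assumes "G \<subseteq> \<B>" "convex G" "G \<noteq> {}"
  shows "\<exists>g\<in>G. \<forall>h\<in>G. \<T> g \<subseteq> \<T> h"
proof -
  obtain g where g: "g \<in> G" "\<And>h. h \<in> G \<Longrightarrow> card (\<T> g) \<le> card (\<T> h)"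
    using ex_has_least_nat[of "\<lambda>g. g \<in> G" _ "\<lambda>g. card (\<T> g)"] assms(3) by blast
  have "\<T> g \<subseteq> \<T> h" if h: "h \<in> G" for h
  proof -
    let ?m = "(1/2) *\<^sub>R g + (1/2) *\<^sub>R h"
    have m: "?m \<in> G" using convexD[OF assms(2) g(1) h] by simp
    have "\<T> ?m = \<T> g \<inter> \<T> h"
      using assms(1) g(1) h by (intro tight_convex_combination) auto
    moreover have "\<T> ?m = \<T> g"
      using calculation g(2)[OF m] by (intro card_seteq finite_tight) auto
    ultimately show ?thesis by blast
  qed
  then show ?thesis using g(1) by blast
qed

text \<open>The direction \<open>g - x\<close> sums to zero over each tight set of \<open>g\<close>, so the polyhedron contains a
  point slightly beyond \<open>g\<close> as seen from \<open>x\<close>. As \<open>g\<close> is inside a segment that starts at \<open>x\<close>, the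
  face through \<open>g\<close> contains \<open>x\<close>.\<close>

lemma face_eq_tight_on:
  assumes G: "G face_of \<B>" and g: "g \<in> G" "\<And>h. h \<in> G \<Longrightarrow> \<T> g \<subseteq> \<T> h"
  shows "G = {x \<in> \<B>. \<T> g \<subseteq> \<T> x}"
proof
  have sub: "G \<subseteq> \<B>" using G by (simp add: face_of_def)
  then show "G \<subseteq> {x \<in> \<B>. \<T> g \<subseteq> \<T> x}" using g by auto
  show "{x \<in> \<B>. \<T> g \<subseteq> \<T> x} \<subseteq> G"
  proof
    fix x assume "x \<in> {x \<in> \<B>. \<T> g \<subseteq> \<T> x}"
    then have x: "x \<in> \<B>" "\<T> g \<subseteq> \<T> x" by auto
    have gP: "g \<in> \<B>" using g sub by blast
    show "x \<in> G"
    proof (cases "x = g")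
      case False
      have "Poly_Mapping.keys (g - x) \<subseteq> I" "coord_sum (g - x) I = 0"
        using gP x keys_diff_subset[of g x] by (auto simp: base_polyhedron_def coord_sum_diff)
      moreover have "coord_sum (g - x) A \<le> 0" if "A \<in> \<T> g" for A
        using that x(2) by (auto simp: tight_def coord_sum_diff)
      ultimately obtain e where e: "e > 0" "g + e *\<^sub>R (g - x) \<in> \<B>"
        using ex_small_step[OF gP] by blast
      \<comment> \<open>the weight for which \<open>g\<close> is the convex combination of \<open>x\<close> and \<open>g + e (g - x)\<close>\<close>
      define u where "u = 1 / (1 + e)"
      have u: "0 < u" "u < 1" "1 - u = u * e" using e by (auto simp: u_def field_simps)
      have "u + u * e = 1" using u by simp
      have "(1 - u) *\<^sub>R x + u *\<^sub>R (g + e *\<^sub>R (g - x)) = (u + u * e) *\<^sub>R g"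
        unfolding u(3) by (simp add: algebra_simps)
      then have g_eq: "g = (1 - u) *\<^sub>R x + u *\<^sub>R (g + e *\<^sub>R (g - x))"
        by (simp add: \<open>u + u * e = 1\<close>)
      moreover have "x \<noteq> g + e *\<^sub>R (g - x)"
      proof
        assume "x = g + e *\<^sub>R (g - x)"
        with g_eq have "g = (1 - u) *\<^sub>R x + u *\<^sub>R x" by metis
        then show False using False by (simp flip: scaleR_add_left)
      qed
      ultimately have "g \<in> open_segment x (g + e *\<^sub>R (g - x))"
        using u by (auto simp: in_segment)
      then show ?thesis using G x(1) e(2) g(1) unfolding face_of_def by blast
    qed (use g in simp)
  qed
qed

section \<open>Saturated sublattices\<close>

lemma tight_Inter:
  assumes "x \<in> \<B>" "finite S" "S \<noteq> {}" "\<And>i. i \<in> S \<Longrightarrow> W i \<in> \<T> x"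
  shows "(\<Inter>i\<in>S. W i) \<in> \<T> x"
  using assms(2-4)
proof (induction S rule: finite_ne_induct)
  case (insert i S)
  then show ?case using tight_Un_Int(2)[OF assms(1), of "W i" "\<Inter>i\<in>S. W i"] by simp
qed simp

lemma tight_Union:
  assumes "x \<in> \<B>" "finite S" "S \<noteq> {}" "\<And>i. i \<in> S \<Longrightarrow> W i \<in> \<T> x"
  shows "(\<Union>i\<in>S. W i) \<in> \<T> x"
  using assms(2-4)
proof (induction S rule: finite_ne_induct)
  case (insert i S)
  then show ?case using tight_Un_Int(1)[OF assms(1), of "W i" "\<Union>i\<in>S. W i"] by simp
qed simp

text \<open>
  If every \<open>j \<in> B - U\<close> can be separated from every \<open>i \<in> U - A\<close> by a tight set, then intersecting
  over \<open>i\<close> and uniting over \<open>j\<close> gives a tight set that contains \<open>B - U\<close> and avoids \<open>U - A\<close>.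
  So either the relative complement of \<open>U\<close> is tight, or some \<open>j\<close> and \<open>i\<close> are inseparable,
  and then mass can be moved from \<open>i\<close> to \<open>j\<close> without leaving the polyhedron.
\<close>

lemma ex_tight_complement:
  assumes x: "x \<in> \<B>" and T: "A \<in> \<T> x" "B \<in> \<T> x" and U: "A \<subset> U" "U \<subset> B"
    and sep: "\<And>i j. i \<in> U - A \<Longrightarrow> j \<in> B - U \<Longrightarrow> \<exists>W\<in>\<T> x. j \<in> W \<and> i \<notin> W"
  shows "A \<union> (B - U) \<in> \<T> x"
proof -
  obtain W where W: "\<And>i j. i \<in> U - A \<Longrightarrow> j \<in> B - U \<Longrightarrow> W i j \<in> \<T> x \<and> j \<in> W i j \<and> i \<notin> W i j"
    using sep by metis
  have fin: "finite B" using T(2) finite_member by (auto simp: tight_def)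
  let ?V = "\<Union>j\<in>B - U. \<Inter>i\<in>U - A. W i j"
  have V: "?V \<in> \<T> x"
    using W U fin by (intro tight_Union tight_Inter x) (auto intro: finite_subset)
  have "A \<union> (?V \<inter> B) = A \<union> (B - U)"
    using W U by blast
  moreover have "A \<union> (?V \<inter> B) \<in> \<T> x"
    using tight_Un_Int(1,2)[OF x] V T by blast
  ultimately show ?thesis by simp
qed

text \<open>
  Take \<open>x\<close> generic among the points that are tight on \<open>D\<close>, and suppose that a set \<open>U \<notin> D\<close> is tight
  at \<open>x\<close>. Choose it between \<open>A, B \<in> D\<close> that are as close as possible; saturation then shows that
  no member of \<open>D\<close> lies strictly between \<open>A\<close> and \<open>B\<close>. If mass can be moved from some
  \<open>i \<in> U - A\<close> to some \<open>j \<in> B - U\<close>, this keeps \<open>D\<close> tight, because no member of \<open>D\<close> separates \<open>i\<close>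
  from \<open>j\<close>, but makes \<open>U\<close> slack, against genericity. Otherwise the complement of \<open>U\<close> between \<open>A\<close>
  and \<open>B\<close> is tight as well, and saturation puts \<open>U\<close> into \<open>D\<close>.
\<close>

lemma ex_base_point_tight_exactly:
  assumes D: "modular_sublattice I F f D" and sat: "saturated F f D"
  shows "\<exists>x\<in>\<B>. \<T> x = D"
proof -
  let ?Q = "{x \<in> \<B>. D \<subseteq> \<T> x}"
  note D' = modular_sublatticeD[OF D]
  have face: "?Q face_of \<B>" using D'(1) by (rule face_of_tight_on)
  have "?Q \<noteq> {}" using ex_base_point_tight_on[OF submodular_lattice_axioms D] by blast
  then obtain x where x: "x \<in> \<B>" "D \<subseteq> \<T> x"
    and generic: "\<And>y. y \<in> \<B> \<Longrightarrow> D \<subseteq> \<T> y \<Longrightarrow> \<T> x \<subseteq> \<T> y"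
    using ex_generic_point[of ?Q] face_of_imp_convex[OF face] by auto
  note mod = tight_Un_Int[OF x(1)]
  have "\<T> x \<subseteq> D"
  proof (rule ccontr)
    assume "\<not> \<T> x \<subseteq> D"
    define gap where "gap = (\<lambda>(A, U, B). A \<in> D \<and> B \<in> D \<and> U \<in> \<T> x - D \<and> A \<subseteq> U \<and> U \<subseteq> B)"
    have "\<exists>t. gap t"
    proof -
      obtain U where "U \<in> \<T> x - D" using \<open>\<not> \<T> x \<subseteq> D\<close> by blast
      then have "gap ({}, U, I)" using D'(2,3) F_sub by (auto simp: gap_def tight_def)
      then show ?thesis by blast
    qed
    then obtain t where t: "gap t"
      and t_min: "\<And>s. gap s \<Longrightarrow> (\<lambda>(A, U, B). card (B - A)) t \<le> (\<lambda>(A, U, B). card (B - A)) s"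
      using ex_has_least_nat[of gap _ "\<lambda>(A, U, B). card (B - A)"] by blast
    obtain A U B where "t = (A, U, B)" by (cases t)
    with t t_min have A: "A \<in> D" and B: "B \<in> D" and U: "U \<in> \<T> x" "U \<notin> D" "A \<subseteq> U" "U \<subseteq> B"
      and min: "\<And>A' U' B'. gap (A', U', B') \<Longrightarrow> card (B - A) \<le> card (B' - A')"
      by (auto simp: gap_def)
    have strict: "A \<subset> U" "U \<subset> B" using A B U by auto
    have AT: "A \<in> \<T> x" and BT: "B \<in> \<T> x" using A B x(2) by auto
    have UF: "U \<in> F" using U by (simp add: tight_def)
    have finB: "finite B" using BT finite_member by (auto simp: tight_def)
    \<comment> \<open>A member \<open>W\<close> strictly between would put \<open>U \<inter> W\<close> and \<open>U \<union> W\<close> into shorter intervals,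
      hence into \<open>D\<close>, and then \<open>U\<close> by saturation for the pair \<open>(U, W)\<close>.\<close>
    have cover: "W = A \<or> W = B" if W: "W \<in> D" "A \<subseteq> W" "W \<subseteq> B" for W
    proof (rule ccontr)
      assume "\<not> (W = A \<or> W = B)"
      then have "card (W - A) < card (B - A)" "card (B - W) < card (B - A)"
        using W finB by (auto intro!: psubset_card_mono)
      then have "\<not> gap (A, U \<inter> W, W)" "\<not> gap (W, U \<union> W, B)"
        using min by fastforce+
      moreover have "U \<inter> W \<in> \<T> x" "U \<union> W \<in> \<T> x" "f (U \<union> W) + f (U \<inter> W) = f U + f W"
        using mod[of U W] U(1) W(1) x(2) by auto
      ultimately have "U \<union> W \<in> D" "U \<inter> W \<in> D"
        using A B U W by (auto simp: gap_def)
      then show False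
        using sat UF W(1) D'(1) U(2) \<open>f (U \<union> W) + f (U \<inter> W) = f U + f W\<close>
        unfolding saturated_def by blast
    qed
    show False
    proof (cases "\<exists>i\<in>U - A. \<exists>j\<in>B - U. \<forall>W\<in>\<T> x. j \<in> W \<longrightarrow> i \<in> W")
      case True
      then obtain i j where i: "i \<in> U" "i \<notin> A" and j: "j \<in> B" "j \<notin> U"
        and ij: "\<And>W. W \<in> \<T> x \<Longrightarrow> j \<in> W \<Longrightarrow> i \<in> W" by blast
      define d :: "'a \<Rightarrow>\<^sub>0 real" where "d = Poly_Mapping.single j 1 - Poly_Mapping.single i 1"
      have d: "coord_sum d W = (if j \<in> W then 1 else 0) - (if i \<in> W then 1 else 0)" if "W \<in> F" for W
        using finite_member[OF that] by (simp add: d_def coord_sum_diff coord_sum_single)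
      have "i \<in> I" "j \<in> I" using i j F_sub BT UF by (auto simp: tight_def)
      then have "Poly_Mapping.keys d \<subseteq> I" "coord_sum d I = 0"
        using keys_diff_subset[of "Poly_Mapping.single j 1" "Poly_Mapping.single i 1"] d[OF ground_F]
        by (auto simp: d_def)
      moreover have "coord_sum d W \<le> 0" if "W \<in> \<T> x" for W
        using ij[OF that] that d[of W] by (auto simp: tight_def)
      ultimately obtain e where e: "e > 0" "x + e *\<^sub>R d \<in> \<B>"
        and T: "\<T> (x + e *\<^sub>R d) \<subseteq> {A \<in> \<T> x. coord_sum d A = 0}"
        using ex_small_step[OF x(1)] by blast
      have "D \<subseteq> \<T> (x + e *\<^sub>R d)"
      proof
        fix W assume W: "W \<in> D"
        have "A \<union> (W \<inter> B) = A \<or> A \<union> (W \<inter> B) = B"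
          using D'(4,5) A B W strict by (intro cover) auto
        then have "i \<in> W \<longleftrightarrow> j \<in> W" using i j strict by blast
        then have "coord_sum d W = 0" using d W D'(1) by auto
        then show "W \<in> \<T> (x + e *\<^sub>R d)"
          using W x(2) by (auto simp: tight_def coord_sum_add coord_sum_scaleR)
      qed
      then have "U \<in> \<T> (x + e *\<^sub>R d)" using generic[OF e(2)] U(1) by blast
      then have "coord_sum d U = 0" using T by blast
      then show False using d[OF UF] i j by simp
    next
      case False
      then have "A \<union> (B - U) \<in> \<T> x"
        by (intro ex_tight_complement[OF x(1) AT BT strict]) blast
      moreover have "U \<union> (A \<union> (B - U)) = B" "U \<inter> (A \<union> (B - U)) = A"
        using strict by blast+
      ultimately show False
        using mod(3)[OF U(1), of "A \<union> (B - U)"] sat UF U(2) A B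
        unfolding saturated_def tight_def by (metis (no_types, lifting) mem_Collect_eq)
    qed
  qed
  then show ?thesis using x by blast
qed

end


section \<open>Preorders and sublattices\<close>

lemma disconnected_union_iff_down_sets:
  assumes A: "A \<in> down_sets I P" and B: "B \<in> down_sets I P"
    and C: "B - A = C1 \<union> C2" "C1 \<inter> C2 = {}" and AB: "A \<subseteq> B"
  shows "disconnected_union P (B - A) C1 C2 \<longleftrightarrow> A \<union> C1 \<in> down_sets I P \<and> A \<union> C2 \<in> down_sets I P"
proof
  assume d: "disconnected_union P (B - A) C1 C2"
  have down: "A \<union> U \<in> down_sets I P"
    if UV: "B - A = U \<union> V" and sep: "\<And>x y. x \<in> V \<Longrightarrow> y \<in> U \<Longrightarrow> (x, y) \<notin> P" for U V
    unfolding down_sets_def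
  proof (intro CollectI conjI allI impI)
    have BI: "B \<subseteq> I" using B by (auto simp: down_sets_def)
    have "A \<union> U \<subseteq> B" using UV AB by blast
    with BI show "A \<union> U \<subseteq> I" by blast
    fix x y assume xy: "y \<in> A \<union> U \<and> (x, y) \<in> P"
    then have "y \<in> B" using \<open>A \<union> U \<subseteq> B\<close> by blast
    then have "x \<in> B" using B xy by (auto simp: down_sets_def)
    show "x \<in> A \<union> U"
    proof (cases "y \<in> A")
      case True
      then show ?thesis using A xy by (auto simp: down_sets_def)
    next
      case False
      then show ?thesis using xy sep \<open>x \<in> B\<close> UV by blast
    qed
  qed
  have "B - A = C2 \<union> C1" using C(1) by blast
  then show "A \<union> C1 \<in> down_sets I P \<and> A \<union> C2 \<in> down_sets I P"
    using down[OF C(1)] down[of C2 C1] d by (simp add: disconnected_union_def)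
next
  assume "A \<union> C1 \<in> down_sets I P \<and> A \<union> C2 \<in> down_sets I P"
  then show "disconnected_union P (B - A) C1 C2"
    using C unfolding disconnected_union_def down_sets_def by blast
qed

lemma down_sets_lattice:
  assumes "preorder_on I P"
  shows "{} \<in> down_sets I P" "I \<in> down_sets I P"
    and "A \<in> down_sets I P \<Longrightarrow> B \<in> down_sets I P \<Longrightarrow> A \<union> B \<in> down_sets I P"
    and "A \<in> down_sets I P \<Longrightarrow> B \<in> down_sets I P \<Longrightarrow> A \<inter> B \<in> down_sets I P"
  using assms by (auto simp: down_sets_def preorder_on_def)

section \<open>Extended real valued submodular functions\<close>

text \<open>The passage from \<open>z\<close> to the real function \<open>f\<close> on the lattice \<open>F\<close>. Values of \<open>f\<close> outside \<open>F\<close>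
  carry no meaning.\<close>

locale extended_submodular =
  fixes I :: "'a set" and z :: "'a set \<Rightarrow> ereal"
  assumes fin: "finite I" and sub: "submodular_on I z"
begin

definition F :: "'a set set" where "F = {A. A \<subseteq> I \<and> z A < \<infinity>}"

definition f :: "'a set \<Rightarrow> real" where "f A = real_of_ereal (z A)"

lemma z_eq: "A \<in> F \<Longrightarrow> z A = ereal (f A)"
  using sub by (cases "z A") (auto simp: F_def f_def submodular_on_def)

lemma F_imp_subset: "A \<in> F \<Longrightarrow> A \<subseteq> I"
  by (simp add: F_def)

lemma not_F: "A \<subseteq> I \<Longrightarrow> A \<notin> F \<Longrightarrow> z A = \<infinity>"
  by (simp add: F_def)

lemma z_sub: "A \<subseteq> I \<Longrightarrow> B \<subseteq> I \<Longrightarrow> z (A \<union> B) + z (A \<inter> B) \<le> z A + z B"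
  using sub by (simp add: submodular_on_def)

lemma lattice_F:
  assumes "A \<in> F" "B \<in> F"
  shows "A \<union> B \<in> F \<and> A \<inter> B \<in> F"
proof (rule ccontr)
  have AB: "A \<subseteq> I" "B \<subseteq> I" using assms by (auto simp: F_def)
  then have "A \<union> B \<subseteq> I" "A \<inter> B \<subseteq> I" by blast+
  moreover assume "\<not> ?thesis"
  ultimately have "z (A \<union> B) = \<infinity> \<or> z (A \<inter> B) = \<infinity>" using not_F by blast
  then have "z (A \<union> B) + z (A \<inter> B) = \<infinity>" by auto
  then have "\<infinity> \<le> z A + z B" using z_sub[OF AB] by metis
  then show False using assms by (simp add: z_eq)
qed

sublocale submodular_lattice I F f
proof
  show "{} \<in> F" "I \<in> F" "f {} = 0" using sub by (auto simp: F_def f_def submodular_on_def)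
  fix A B assume AB: "A \<in> F" "B \<in> F"
  then show "f (A \<union> B) + f (A \<inter> B) \<le> f A + f B"
    using z_sub[of A B] lattice_F[OF AB] F_imp_subset[OF AB(1)] F_imp_subset[OF AB(2)]
    by (simp add: z_eq)
qed (use fin lattice_F F_imp_subset in auto)

lemma gen_perm_eq: "gen_perm I z = \<B>"
proof -
  have "gen_perm I z = {x. Poly_Mapping.keys x \<subseteq> I \<and> ereal (coord_sum x I) = z I \<and>
      (\<forall>A\<in>F. ereal (coord_sum x A) \<le> z A)}"
    by (auto simp: gen_perm_def F_def)
  then show ?thesis by (simp add: base_polyhedron_def z_eq ground_F)
qed

lemma tight_sets_eq: "G \<noteq> {} \<Longrightarrow> tight_sets I z G = (\<Inter>g\<in>G. \<T> g)"
proof -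
  have "tight_sets I z G = {A \<in> F. \<forall>x\<in>G. ereal (coord_sum x A) = z A}"
    by (auto simp: tight_sets_def F_def)
  moreover assume "G \<noteq> {}"
  ultimately show ?thesis by (auto simp: tight_def z_eq)
qed

lemma Phi_eq: "down_sets I P \<subseteq> F \<Longrightarrow> Phi I z P = {x \<in> \<B>. down_sets I P \<subseteq> \<T> x}"
  using z_eq by (auto simp: Phi_def gen_perm_eq tight_def subset_iff)

text \<open>
  The equation for \<open>E = B - A\<close> implies all others. Submodularity for the pair \<open>A \<union> C\<^sub>1\<close>, \<open>A \<union> E\<close> and
  then for \<open>A \<union> C\<^sub>2\<close>, \<open>A \<union> C\<^sub>1 \<union> E\<close> bounds the values at \<open>A \<union> (E \<inter> C\<^sub>1)\<close> and \<open>A \<union> (E \<inter> C\<^sub>2)\<close> from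
  above; the opposite inequality is submodularity for these two sets. The same pairs, through the
  lattice \<open>F\<close>, show that both sides are infinite together.
\<close>

lemma decomposes_iff:
  assumes A: "A \<in> F" and B: "B \<in> F" and AB: "A \<subseteq> B"
    and C: "B - A = C1 \<union> C2" "C1 \<inter> C2 = {}"
  shows "decomposes (minor z A) (B - A) C1 C2 \<longleftrightarrow>
           A \<union> C1 \<in> F \<and> A \<union> C2 \<in> F \<and> f (A \<union> C1) + f (A \<union> C2) = f A + f B"
    (is "_ \<longleftrightarrow> ?R")
proof -
  have parts: "A \<union> C1 \<subseteq> I" "A \<union> C2 \<subseteq> I" and BI: "B \<subseteq> I" using F_sub[OF B] AB C by blast+
  note zA = z_eq[OF A] and zB = z_eq[OF B]
  show ?thesis
  proof
    assume "decomposes (minor z A) (B - A) C1 C2"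
    moreover have "(B - A) \<inter> C1 = C1" "(B - A) \<inter> C2 = C2" "A \<union> (B - A) = B" using C AB by blast+
    ultimately have *: "z B - z A = (z (A \<union> C1) - z A) + (z (A \<union> C2) - z A)"
      by (metis decomposes_def minor_def order_refl)
    have "z (A \<union> C1) \<noteq> - \<infinity>" "z (A \<union> C2) \<noteq> - \<infinity>"
      using parts sub
      by (simp_all add: submodular_on_def)
    then have F: "A \<union> C1 \<in> F" "A \<union> C2 \<in> F"
      using * parts zA zB by (cases "z (A \<union> C1)"; cases "z (A \<union> C2)"; simp add: F_def)+
    then show ?R using * by (simp add: z_eq A B)
  next
    assume R: ?R
    show "decomposes (minor z A) (B - A) C1 C2"
      unfolding decomposes_def
    proof (intro conjI allI impI)
      fix E assume E: "E \<subseteq> B - A"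
      let ?E1 = "A \<union> (E \<inter> C1)" and ?E2 = "A \<union> (E \<inter> C2)" and ?E = "A \<union> E"
      have E': "?E1 \<union> ?E2 = ?E" "?E1 \<inter> ?E2 = A"
        "(A \<union> C1) \<inter> ?E = ?E1" "(A \<union> C2) \<inter> ((A \<union> C1) \<union> ?E) = ?E2"
        "(A \<union> C2) \<union> ((A \<union> C1) \<union> ?E) = B"
        using E C AB by blast+
      have "?E1 \<subseteq> I" "?E2 \<subseteq> I" "?E \<subseteq> I" using E C AB BI by blast+
      show "minor z A E = minor z A (E \<inter> C1) + minor z A (E \<inter> C2)"
      proof (cases "?E \<in> F")
        case True
        then have F: "?E1 \<in> F" "?E2 \<in> F" "(A \<union> C1) \<union> ?E \<in> F"
          using R Int_F[of "A \<union> C1" ?E] Un_F[of "A \<union> C1" ?E]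
            Int_F[of "A \<union> C2" "(A \<union> C1) \<union> ?E"] by (simp_all only: E')
        have "f ?E + f A \<le> f ?E1 + f ?E2"
          using submod[OF F(1,2)] by (simp only: E')
        moreover have "f ((A \<union> C1) \<union> ?E) + f ?E1 \<le> f (A \<union> C1) + f ?E"
          using submod[of "A \<union> C1" ?E] R True by (simp only: E')
        moreover have "f B + f ?E2 \<le> f (A \<union> C2) + f ((A \<union> C1) \<union> ?E)"
          using submod[of "A \<union> C2" "(A \<union> C1) \<union> ?E"] R F(3) by (simp only: E')
        ultimately have "f ?E - f A = (f ?E1 - f A) + (f ?E2 - f A)"
          using R by linarith
        then show ?thesis using F True A by (simp add: minor_def z_eq)
      next
        case False
        then have "?E1 \<notin> F \<or> ?E2 \<notin> F" using Un_F[of ?E1 ?E2] by (auto simp only: E')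
        then have "z ?E1 = \<infinity> \<or> z ?E2 = \<infinity>"
          using not_F \<open>?E1 \<subseteq> I\<close> \<open>?E2 \<subseteq> I\<close> by blast
        then show ?thesis
          using False not_F[OF \<open>?E \<subseteq> I\<close>] zA by (auto simp: minor_def)
      qed
    qed (use C in auto)
  qed
qed

text \<open>Two down-sets \<open>U\<close> and \<open>V\<close> split the convex set \<open>(U \<union> V) - (U \<inter> V)\<close> into the mutually
  incomparable parts \<open>U - V\<close> and \<open>V - U\<close>, and every disconnected union of a convex set arises in
  this way. So compatibility is modularity of \<open>f\<close> on pairs of down-sets.\<close>

lemma compatible_iff:
  "compatible I z P \<longleftrightarrow> preorder_on I P \<and> modular_sublattice I F f (down_sets I P)"
proof (intro iffI conjI)
  assume comp: "compatible I z P"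
  then show P: "preorder_on I P" by (simp add: compatible_def)
  have dec: "decomposes (minor z A) (B - A) C1 C2"
    if "A \<in> down_sets I P" "B \<in> down_sets I P" "A \<subseteq> B" "disconnected_union P (B - A) C1 C2"
    for A B C1 C2
    using comp that unfolding compatible_def by simp
  note L = down_sets_lattice[OF P]
  have DF: "down_sets I P \<subseteq> F"
    using comp by (auto simp: compatible_def F_def down_sets_def)
  show "modular_sublattice I F f (down_sets I P)"
    unfolding modular_sublattice_def
  proof (intro conjI ballI DF L)
    fix U V assume UV: "U \<in> down_sets I P" "V \<in> down_sets I P"
    let ?A = "U \<inter> V" and ?B = "U \<union> V"
    have A: "?A \<in> down_sets I P" and B: "?B \<in> down_sets I P" using L UV by auto
    have C: "?B - ?A = (U - V) \<union> (V - U)" "(U - V) \<inter> (V - U) = {}"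
      and eq: "?A \<union> (U - V) = U" "?A \<union> (V - U) = V" by blast+
    have "disconnected_union P (?B - ?A) (U - V) (V - U)"
      using disconnected_union_iff_down_sets[OF A B C] UV by (simp add: eq le_supI1)
    then have "decomposes (minor z ?A) (?B - ?A) (U - V) (V - U)"
      by (intro dec A B) blast
    then show "f ?B + f ?A = f U + f V"
      using decomposes_iff[OF _ _ _ C] A B DF by (simp add: eq le_supI1 subset_iff)
  qed
next
  assume *: "preorder_on I P \<and> modular_sublattice I F f (down_sets I P)"
  then have P: "preorder_on I P" by blast
  note D = modular_sublatticeD[OF conjunct2[OF *]]
  show "compatible I z P"
    unfolding compatible_def
  proof (intro conjI ballI allI impI P)
    fix A assume "A \<in> down_sets I P"
    then show "z A < \<infinity>" using D(1) by (auto simp: F_def)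
  next
    fix A B C1 C2
    assume A: "A \<in> down_sets I P" and B: "B \<in> down_sets I P" and AB: "A \<subseteq> B"
      and d: "disconnected_union P (B - A) C1 C2"
    have C: "B - A = C1 \<union> C2" "C1 \<inter> C2 = {}" using d by (auto simp: disconnected_union_def)
    have U: "A \<union> C1 \<in> down_sets I P" "A \<union> C2 \<in> down_sets I P"
      using disconnected_union_iff_down_sets[OF A B C AB] d by auto
    have "(A \<union> C1) \<union> (A \<union> C2) = B" "(A \<union> C1) \<inter> (A \<union> C2) = A" using C AB by blast+
    then have "f (A \<union> C1) + f (A \<union> C2) = f A + f B"
      using D(6)[OF U] by simp
    then show "decomposes (minor z A) (B - A) C1 C2"
      using decomposes_iff[OF _ _ AB C] A B U D(1) by blast
  qed
qed

lemma conforms_iff: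
  "conforms I z P \<longleftrightarrow>
     preorder_on I P \<and> modular_sublattice I F f (down_sets I P) \<and> saturated F f (down_sets I P)"
proof (cases "compatible I z P")
  case True
  then have P: "preorder_on I P" and M: "modular_sublattice I F f (down_sets I P)"
    by (simp_all add: compatible_iff)
  note D = modular_sublatticeD[OF M]
  have "conforms I z P \<longleftrightarrow> saturated F f (down_sets I P)"
  proof
    assume conf: "conforms I z P"
    show "saturated F f (down_sets I P)"
      unfolding saturated_def
    proof (intro ballI impI)
      fix U V assume UV: "U \<in> F" "V \<in> F"
      let ?A = "U \<inter> V" and ?B = "U \<union> V"
      assume *: "?B \<in> down_sets I P \<and> ?A \<in> down_sets I P \<and> f ?B + f ?A = f U + f V"
      have AB: "?A \<subseteq> ?B" and C: "?B - ?A = (U - V) \<union> (V - U)" "(U - V) \<inter> (V - U) = {}"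
        and eq: "?A \<union> (U - V) = U" "?A \<union> (V - U) = V" by blast+
      have "decomposes (minor z ?A) (?B - ?A) (U - V) (V - U)"
        using decomposes_iff[OF _ _ AB C] * UV D(1) by (simp add: eq subset_iff)
      then have "disconnected_union P (?B - ?A) (U - V) (V - U)"
        using conf * AB unfolding conforms_def by blast
      then show "U \<in> down_sets I P \<and> V \<in> down_sets I P"
        using disconnected_union_iff_down_sets[where I = I and P = P, OF _ _ C AB] * by (simp add: eq)
    qed
  next
    assume sat: "saturated F f (down_sets I P)"
    show "conforms I z P"
      unfolding conforms_def
    proof (intro conjI ballI allI impI True)
      fix A B C1 C2
      assume A: "A \<in> down_sets I P" and B: "B \<in> down_sets I P" and AB: "A \<subseteq> B"
        and d: "decomposes (minor z A) (B - A) C1 C2"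
      have C: "B - A = C1 \<union> C2" "C1 \<inter> C2 = {}" using d by (auto simp: decomposes_def)
      have U: "A \<union> C1 \<in> F" "A \<union> C2 \<in> F" "f (A \<union> C1) + f (A \<union> C2) = f A + f B"
        using decomposes_iff[OF _ _ AB C] d A B D(1) by auto
      have "(A \<union> C1) \<union> (A \<union> C2) = B" "(A \<union> C1) \<inter> (A \<union> C2) = A" using C AB by blast+
      then have "A \<union> C1 \<in> down_sets I P \<and> A \<union> C2 \<in> down_sets I P"
        using sat U A B unfolding saturated_def by (metis add.commute)
      then show "disconnected_union P (B - A) C1 C2"
        using disconnected_union_iff_down_sets[OF A B C AB] by blast
    qed
  qed
  then show ?thesis using P M by blast
next
  case False
  then show ?thesis by (auto simp: conforms_def compatible_iff)
qed

lemma Psi_preorder: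
  assumes M: "modular_sublattice I F f (tight_sets I z G)"
  shows "preorder_on I (Psi I z G)" "down_sets I (Psi I z G) = tight_sets I z G"
proof -
  note D = modular_sublatticeD[OF M]
  have "\<exists>!P. preorder_on I P \<and> down_sets I P = tight_sets I z G"
    by (rule ex1_preorder_of_topology[OF fin _ D(2,3,4,5)]) (auto simp: tight_sets_def)
  from theI'[OF this] show "preorder_on I (Psi I z G)" "down_sets I (Psi I z G) = tight_sets I z G"
    by (simp_all add: Psi_def)
qed

lemma Psi_eqI:
  assumes P: "preorder_on I P" "down_sets I P = tight_sets I z G"
  shows "Psi I z G = P"
proof -
  have "\<exists>!P. preorder_on I P \<and> down_sets I P = tight_sets I z G"
    using down_sets_lattice[OF P(1)] unfolding P(2)
    by (intro ex1_preorder_of_topology fin) (auto simp: tight_sets_def)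
  from the1_equality[OF this] P show ?thesis by (simp add: Psi_def)
qed

lemma Phi_nonempty_face:
  assumes "compatible I z P"
  shows "Phi I z P \<in> nonempty_faces I z"
proof -
  have M: "modular_sublattice I F f (down_sets I P)" using assms by (simp add: compatible_iff)
  note D = modular_sublatticeD(1)[OF M]
  show ?thesis
    using face_of_tight_on[OF D] ex_base_point_tight_on[OF submodular_lattice_axioms M]
    by (auto simp: nonempty_faces_def gen_perm_eq Phi_eq[OF D])
qed

lemma Psi_conforms_and_Phi_Psi:
  assumes "G \<in> nonempty_faces I z"
  shows "conforms I z (Psi I z G)" "Phi I z (Psi I z G) = G"
proof -
  have G: "G face_of \<B>" "G \<noteq> {}" "G \<subseteq> \<B>"
    using assms by (auto simp: nonempty_faces_def gen_perm_eq face_of_def)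
  obtain g where g: "g \<in> G" "\<And>h. h \<in> G \<Longrightarrow> \<T> g \<subseteq> \<T> h"
    using ex_generic_point[OF G(3) face_of_imp_convex[OF G(1)] G(2)] by blast
  have gB: "g \<in> \<B>" using g G by blast
  have T: "tight_sets I z G = \<T> g" using g G(2) by (auto simp: tight_sets_eq)
  have M: "modular_sublattice I F f (tight_sets I z G)"
    using modular_sublattice_tight[OF gB] by (simp add: T)
  note P = Psi_preorder[OF M]
  show "conforms I z (Psi I z G)"
    using P M saturated_tight[OF gB] by (simp add: conforms_iff T)
  have "down_sets I (Psi I z G) \<subseteq> F" using P(2) T by (auto simp: tight_def)
  then have "Phi I z (Psi I z G) = {x \<in> \<B>. \<T> g \<subseteq> \<T> x}"
    by (simp add: Phi_eq P(2) T)
  then show "Phi I z (Psi I z G) = G"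
    using face_eq_tight_on[OF G(1) g] by metis
qed

lemma Psi_Phi:
  assumes "conforms I z P"
  shows "Psi I z (Phi I z P) = P"
proof -
  have P: "preorder_on I P" and M: "modular_sublattice I F f (down_sets I P)"
    and sat: "saturated F f (down_sets I P)" using assms by (auto simp: conforms_iff)
  note Phi = Phi_eq[OF modular_sublatticeD(1)[OF M]]
  obtain x where x: "x \<in> \<B>" "\<T> x = down_sets I P"
    using ex_base_point_tight_exactly[OF M sat] by blast
  then have "x \<in> Phi I z P" by (simp add: Phi)
  then have "tight_sets I z (Phi I z P) = down_sets I P"
    using x by (subst tight_sets_eq) (auto simp: Phi)
  then show ?thesis using Psi_eqI[OF P] by simp
qed

end

theorem theorem8p4:
  fixes I :: "'a set" and z :: "'a set \<Rightarrow> ereal"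
  assumes "finite I" and "submodular_on I z"
  shows "Phi I z ` {P. compatible I z P} = nonempty_faces I z \<and>
         Psi I z ` nonempty_faces I z = Pre I z \<and>
         bij_betw (Phi I z) (Pre I z) (nonempty_faces I z) \<and>
         bij_betw (Psi I z) (nonempty_faces I z) (Pre I z) \<and>
         (\<forall>P\<in>Pre I z. Psi I z (Phi I z P) = P) \<and>
         (\<forall>G\<in>nonempty_faces I z. Phi I z (Psi I z G) = G)"
proof -
  interpret extended_submodular I z using assms by unfold_locales
  have sub: "Pre I z \<subseteq> {P. compatible I z P}" by (auto simp: Pre_def conforms_def)
  have Phi: "Phi I z P \<in> nonempty_faces I z" if "compatible I z P" for P
    using that by (rule Phi_nonempty_face)
  have Psi: "Psi I z G \<in> Pre I z" "Phi I z (Psi I z G) = G" if "G \<in> nonempty_faces I z" for G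
    using Psi_conforms_and_Phi_Psi[OF that] by (simp_all add: Pre_def)
  have Psi_Phi': "Psi I z (Phi I z P) = P" if "P \<in> Pre I z" for P
    using Psi_Phi that by (simp add: Pre_def)
  have "bij_betw (Phi I z) (Pre I z) (nonempty_faces I z)"
    by (rule bij_betw_byWitness[of _ "Psi I z"]) (use Phi Psi Psi_Phi' sub in auto)
  moreover have "bij_betw (Psi I z) (nonempty_faces I z) (Pre I z)"
    by (rule bij_betw_byWitness[of _ "Phi I z"]) (use Phi Psi Psi_Phi' sub in auto)
  moreover have "Phi I z ` {P. compatible I z P} = nonempty_faces I z"
  proof
    show "Phi I z ` {P. compatible I z P} \<subseteq> nonempty_faces I z" using Phi by auto
    show "nonempty_faces I z \<subseteq> Phi I z ` {P. compatible I z P}"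
      using \<open>bij_betw (Phi I z) (Pre I z) (nonempty_faces I z)\<close> sub
      unfolding bij_betw_def by blast
  qed
  ultimately show ?thesis using Psi Psi_Phi' by (auto simp: bij_betw_def)
qed

end
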